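(* For all integers $n$ and $k$ with $0 < k < n$, the Full-Flag Johnson graph $FJ(n,k)$ is connected.
   Context: For a permutation $u=(u_1,\ldots,u_n)$ of $(1,2,\ldots,n)$ and $i \in [n]=\{1,\ldots,n\}$ write $u(i) = \{u_1, u_2, \ldots, u_i\}$. For integers $0 \leq k < n$, the Full-Flag Johnson graph $FJ(n,k)$ has as vertex set all permutations of $(1,\ldots,n)$; two vertices $u,v$ are adjacent if and only if $u(i) \neq v(i)$ for exactly $k$ integers $i \in [n]$. The graph is called non-trivial when $k>0$. *)

theory Defs
  imports
    "HOL-Combinatorics.Multiset_Permutations"
    "Graph_Theory.Pair_Digraph"
    "Graph_Theory.Digraph_Component"
begin

(* A permutation (u_1, ..., u_n) is the list [u_1, ..., u_n], an element of
   permutations_of_set {1..n}. *)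

definition initial_set :: "'a list \<Rightarrow> nat \<Rightarrow> 'a set" where
  "initial_set u i = set (take i u)"

(* An undirected graph is represented by its symmetric set of ordered pairs of adjacent
   vertices. For k = 0 the definition puts a loop at every vertex; for k > 0 the graph is
   simple, see pair_graph_full_flag_johnson. *)

definition full_flag_johnson :: "nat \<Rightarrow> nat \<Rightarrow> nat list pair_pre_digraph" where
  "full_flag_johnson n k =
    \<lparr> pverts = permutations_of_set {1..n},
      parcs = {(u, v). u \<in> permutations_of_set {1..n} \<and> v \<in> permutations_of_set {1..n} \<and>
                 card {i \<in> {1..n}. initial_set u i \<noteq> initial_set v i} = k} \<rparr>"

lemma pair_graph_full_flag_johnson:
  assumes "k > 0"
  shows "pair_graph (full_flag_johnson n k)"
proof -
  let ?G = "full_flag_johnson n k"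
  have subset: "parcs ?G \<subseteq> pverts ?G \<times> pverts ?G"
    by (auto simp: full_flag_johnson_def)
  have finite: "finite (pverts ?G)"
    by (simp add: full_flag_johnson_def)
  have symmetric: "sym (parcs ?G)"
  proof (rule symI)
    fix u v assume "(u, v) \<in> parcs ?G"
    moreover have "{i \<in> {1..n}. initial_set v i \<noteq> initial_set u i}
        = {i \<in> {1..n}. initial_set u i \<noteq> initial_set v i}"
      by (rule Collect_cong) metis
    ultimately show "(v, u) \<in> parcs ?G"
      by (simp add: full_flag_johnson_def)
  qed
  have loopfree: "(u, u) \<notin> parcs ?G" for u
    using assms by (simp add: full_flag_johnson_def)
  show ?thesis
  proof unfold_locales
    fix e assume e: "e \<in> parcs ?G"
    show "fst e \<in> pverts ?G" and "snd e \<in> pverts ?G"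
      using e subset by (auto simp: mem_Times_iff)
    show "fst e \<noteq> snd e"
      using e loopfree by (metis prod.collapse)
  next
    show "finite (pverts ?G)" by (rule finite)
    show "finite (parcs ?G)"
      using subset finite by (meson finite_SigmaI finite_subset)
    show "symmetric (with_proj ?G)"
      using symmetric by (simp add: symmetric_def)
  qed
qed

end

theory Submission
  imports Defs
begin

text \<open>
  Any two permutations are joined by a chain of transpositions of adjacent entries, so it suffices
  to connect two permutations \<open>u\<close> and \<open>u'\<close> that differ by such a transposition. For \<open>k = 1\<close> they
  are adjacent. For \<open>k \<ge> 2\<close> choose a window of \<open>k + 1\<close> positions containing the two transposed
  ones; reversing this window in \<open>u\<close> gives a common neighbour of \<open>u\<close> and \<open>u'\<close>. Indeed, two
  arrangements of the window, one of which begins with the last entry of the other, have different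
  initial sets at each of the \<open>k\<close> inner cuts. As the window has at least three entries, the
  transposition fixes its first or its last entry.
\<close>

definition adjacent_swaps :: "('a list \<times> 'a list) set" where
  "adjacent_swaps = {(A @ [a, b] @ B, A @ [b, a] @ B) | A a b B. True}"

lemma adjacent_swapsI: "(A @ [a, b] @ B, A @ [b, a] @ B) \<in> adjacent_swaps"
  unfolding adjacent_swaps_def by blast

lemma adjacent_swaps_rtrancl_Cons:
  assumes "(xs, ys) \<in> adjacent_swaps\<^sup>*"
  shows "(x # xs, x # ys) \<in> adjacent_swaps\<^sup>*"
  using assms
proof induction
  case base
  show ?case by simp
next
  case (step ys zs)
  then obtain A a b B where "ys = A @ [a, b] @ B" "zs = A @ [b, a] @ B"
    unfolding adjacent_swaps_def by blast
  then have "(x # ys, x # zs) \<in> adjacent_swaps"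
    using adjacent_swapsI[of "x # A" a b B] by simp
  with step.IH show ?case by (rule rtrancl_into_rtrancl)
qed

lemma adjacent_swaps_rtrancl_move_head:
  "(x # p @ q, p @ x # q) \<in> adjacent_swaps\<^sup>*"
proof (induction p)
  case Nil
  show ?case by simp
next
  case (Cons y p)
  have "(x # y # p @ q, y # x # p @ q) \<in> adjacent_swaps"
    using adjacent_swapsI[of "[]" x y "p @ q"] by simp
  with adjacent_swaps_rtrancl_Cons[OF Cons.IH, of y] show ?case
    by (simp add: converse_rtrancl_into_rtrancl)
qed

text \<open>Insertion sort towards \<open>ys\<close>: with \<open>x\<close> held in front, the
  induction hypothesis rearranges the tail into \<open>ys\<close> without one occurrence of
  \<open>x\<close>; then \<open>x\<close> moves right to its place.\<close>

lemma mset_eq_imp_adjacent_swaps_rtrancl: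
  assumes "mset xs = mset ys"
  shows "(xs, ys) \<in> adjacent_swaps\<^sup>*"
  using assms
proof (induction xs arbitrary: ys)
  case Nil
  then show ?case by simp
next
  case (Cons x xs)
  then have "x \<in> set ys" by (metis list.set_intros(1) mset_eq_setD)
  then obtain p q where ys: "ys = p @ x # q" by (meson split_list)
  with Cons.prems have "mset xs = mset (p @ q)" by simp
  then have "(x # xs, x # p @ q) \<in> adjacent_swaps\<^sup>*"
    by (intro adjacent_swaps_rtrancl_Cons Cons.IH)
  also have "(x # p @ q, ys) \<in> adjacent_swaps\<^sup>*"
    unfolding ys by (rule adjacent_swaps_rtrancl_move_head)
  finally show ?case .
qed

text \<open>The common entry \<open>hd V = last W\<close> lies in every nonempty initial set of
  \<open>V\<close>, but in no proper one of \<open>W\<close>, since \<open>W\<close> has no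
  repetition.\<close>

lemma initial_set_neq_if_hd_eq_last:
  assumes "distinct W" "hd V = last W" "length V = length W" "0 < i" "i < length W"
  shows "initial_set V i \<noteq> initial_set W i"
proof -
  have "V \<noteq> []" and "W \<noteq> []" using assms by auto
  have "hd V \<in> initial_set V i"
    using \<open>V \<noteq> []\<close> \<open>0 < i\<close> unfolding initial_set_def
    by (metis hd_in_set hd_take less_numeral_extra(3) take_eq_Nil)
  moreover have "last W \<notin> initial_set W i"
  proof -
    have "last W \<in> set (drop i W)"
      using \<open>i < length W\<close> by (metis drop_eq_Nil last_drop last_in_set not_le)
    then show ?thesis
      using set_take_disj_set_drop_if_distinct[OF \<open>distinct W\<close>, of i i]
      unfolding initial_set_def by blast
  qed
  ultimately show ?thesis using \<open>hd V = last W\<close> by metis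
qed

text \<open>Cuts outside the window or at its borders see equal sets, as \<open>V\<close> rearranges
  \<open>W\<close>. That leaves the \<open>k\<close> inner cuts of a window of \<open>k + 1\<close>
  entries, all of which differ by \<open>ends\<close>.\<close>

lemma full_flag_johnson_window_arc:
  assumes perm: "A @ W @ B \<in> permutations_of_set {1..n}"
    and mset: "mset V = mset W"
    and len: "length W = Suc k"
    and ends: "hd V = last W \<or> hd W = last V"
  shows "(A @ W @ B, A @ V @ B) \<in> parcs (full_flag_johnson n k)"
proof -
  let ?u = "A @ W @ B" and ?v = "A @ V @ B"
  have lenV: "length V = length W" and setV: "set V = set W"
    using mset by (metis mset_eq_length, metis mset_eq_setD)
  have u: "set ?u = {1..n}" "distinct ?u"
    using permutations_of_setD[OF perm] by auto
  have "mset ?v = mset ?u" using mset by simp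
  with u have v: "set ?v = {1..n}" "distinct ?v"
    by (metis mset_eq_setD, metis mset_eq_imp_distinct_iff)
  have n: "length A + Suc k + length B = n"
    using length_finite_permutations_of_set[OF perm] len by simp
  have inner: "initial_set W j \<noteq> initial_set V j" if "0 < j" "j < length W" for j
    using ends initial_set_neq_if_hd_eq_last[of W V j] initial_set_neq_if_hd_eq_last[of V W j]
      u v lenV that by auto
  \<comment> \<open>The part from \<open>A\<close> cancels because it is disjoint from the window.
    For \<open>i \<le> length A\<close> the truncated subtraction gives 0, and both window sets are
    empty.\<close>
  have window: "initial_set ?u i = initial_set ?v i \<longleftrightarrow>
      initial_set W (i - length A) = initial_set V (i - length A)" if "i \<le> length A + length W" for i
  proof -
    have "set A \<inter> set W = {}" using u by auto
    moreover have "initial_set W (i - length A) \<subseteq> set W" "initial_set V (i - length A) \<subseteq> set W"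
      unfolding initial_set_def using setV by (auto dest: in_set_takeD)
    moreover have "initial_set ?u i = set (take i A) \<union> initial_set W (i - length A)"
      "initial_set ?v i = set (take i A) \<union> initial_set V (i - length A)"
      using that lenV by (auto simp: initial_set_def)
    moreover have "set (take i A) \<subseteq> set A" by (rule set_take_subset)
    ultimately show ?thesis by blast
  qed
  have "{i \<in> {1..n}. initial_set ?u i \<noteq> initial_set ?v i} = {length A<..length A + k}"
  proof (intro set_eqI iffI)
    fix i assume i: "i \<in> {length A<..length A + k}"
    then have "i \<le> length A + length W" "0 < i - length A" "i - length A < length W" "i \<in> {1..n}"
      using len n by auto
    with window inner show "i \<in> {i \<in> {1..n}. initial_set ?u i \<noteq> initial_set ?v i}" by blast
  next
    fix i assume i: "i \<in> {i \<in> {1..n}. initial_set ?u i \<noteq> initial_set ?v i}"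
    have "length A < i"
      using i by (rule_tac ccontr) (simp add: initial_set_def)
    moreover have "i \<le> length A + k"
    proof (rule ccontr)
      assume "\<not> i \<le> length A + k"
      then have "initial_set ?u i = initial_set ?v i"
        using len lenV setV by (simp add: initial_set_def)
      with i show False by simp
    qed
    ultimately show "i \<in> {length A<..length A + k}" by simp
  qed
  then have "card {i \<in> {1..n}. initial_set ?u i \<noteq> initial_set ?v i} = k" by simp
  moreover have "?v \<in> permutations_of_set {1..n}"
    using v by (rule permutations_of_setI)
  ultimately show ?thesis
    using perm by (simp add: full_flag_johnson_def)
qed

lemma adjacent_swap_reachable:
  assumes k: "0 < k" "k < n"
    and u: "A @ [a, b] @ B \<in> permutations_of_set {1..n}"
  shows "(A @ [a, b] @ B, A @ [b, a] @ B) \<in> (parcs (full_flag_johnson n k))\<^sup>*"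
proof (cases "k = 1")
  case True
  have "(A @ [a, b] @ B, A @ [b, a] @ B) \<in> parcs (full_flag_johnson n k)"
    by (rule full_flag_johnson_window_arc[OF u]) (simp_all add: True)
  then show ?thesis by blast
next
  case False
  have n: "length A + length B + 2 = n"
    using length_finite_permutations_of_set[OF u] by simp
  \<comment> \<open>Besides \<open>a\<close> and \<open>b\<close> the window needs
    \<open>k - 1\<close> entries: as many as possible come from the front of \<open>B\<close>, the
    rest from the end of \<open>A\<close>. Enough exist because \<open>k < n\<close>.\<close>
  define y where "y = min (k - 1) (length B)"
  define x where "x = k - 1 - y"
  define A' X where "A' = take (length A - x) A" and "X = drop (length A - x) A"
  define Y B' where "Y = take y B" and "B' = drop y B"
  define W W' where "W = X @ [a, b] @ Y" and "W' = X @ [b, a] @ Y"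
  have x: "x \<le> length A" and y: "y \<le> length B" and xy: "Suc (x + y) = k"
    using n k unfolding x_def y_def by auto
  have A: "A = A' @ X" and B: "B = Y @ B'"
    by (simp_all add: A'_def X_def Y_def B'_def)
  have lenX: "length X = x" and lenY: "length Y = y"
    using x y by (simp_all add: X_def Y_def)
  have len: "length W = Suc k" "length W' = Suc k"
    using lenX lenY xy by (simp_all add: W_def W'_def)
  have perm: "A' @ W @ B' \<in> permutations_of_set {1..n}"
    using u by (simp add: A B W_def)
  have ends: "hd W' = hd W \<or> last W' = last W"
  proof (cases "Y = []")
    case True
    then have "X \<noteq> []" using xy lenX lenY \<open>k \<noteq> 1\<close> by auto
    then show ?thesis by (simp add: W_def W'_def)
  next
    case False
    then show ?thesis by (simp add: W_def W'_def)
  qed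
  have arc1: "(A' @ W @ B', A' @ rev W @ B') \<in> parcs (full_flag_johnson n k)"
    by (rule full_flag_johnson_window_arc[OF perm]) (simp_all add: len hd_rev)
  then have "A' @ rev W @ B' \<in> permutations_of_set {1..n}"
    by (simp add: full_flag_johnson_def)
  \<comment> \<open>\<open>rev W\<close> starts with \<open>last W\<close> and ends with
    \<open>hd W\<close>, so an end that \<open>W\<close> and \<open>W'\<close> share sits at the
    opposite end of \<open>rev W\<close>.\<close>
  then have arc2: "(A' @ rev W @ B', A' @ W' @ B') \<in> parcs (full_flag_johnson n k)"
    by (rule full_flag_johnson_window_arc)
      (use ends len in \<open>auto simp: hd_rev last_rev W_def W'_def\<close>)
  from arc1 arc2 have "(A' @ W @ B', A' @ W' @ B') \<in> (parcs (full_flag_johnson n k))\<^sup>*"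
    by (meson r_into_rtrancl rtrancl_into_rtrancl)
  then show ?thesis by (simp add: A B W_def W'_def)
qed

theorem theorem2p5:
  fixes n k :: nat
  assumes "0 < k" and "k < n"
  shows "Digraph_Component.connected (with_proj (full_flag_johnson n k))"
proof -
  let ?G = "full_flag_johnson n k"
  interpret pair_graph ?G
    using assms(1) by (rule pair_graph_full_flag_johnson)
  have verts: "pverts ?G = permutations_of_set {1..n}"
    by (simp add: full_flag_johnson_def)
  have reachable: "u \<rightarrow>\<^sup>*\<^bsub>?G\<^esub> v" if u: "u \<in> pverts ?G" and v: "v \<in> pverts ?G" for u v
  proof -
    have "mset u = mset v"
      using u v unfolding verts
      by (metis permutations_of_setD set_eq_iff_mset_eq_distinct)
    then have "(u, v) \<in> adjacent_swaps\<^sup>*"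
      by (rule mset_eq_imp_adjacent_swaps_rtrancl)
    \<comment> \<open>Membership in the vertex set is carried along, since each swap must start at a
      permutation.\<close>
    then have "(u, v) \<in> (parcs ?G)\<^sup>* \<and> v \<in> pverts ?G"
    proof induction
      case base
      show ?case using u by simp
    next
      case (step w z)
      then obtain A a b B where w: "w = A @ [a, b] @ B" and z: "z = A @ [b, a] @ B"
        unfolding adjacent_swaps_def by blast
      have "(w, z) \<in> (parcs ?G)\<^sup>*"
        using step.IH adjacent_swap_reachable[OF assms] unfolding w z verts by blast
      moreover have "z \<in> pverts ?G"
        using step.IH unfolding w z verts permutations_of_set_def by auto
      ultimately show ?case using step.IH by (meson rtrancl_trans)
    qed
    then show ?thesis using u by (simp add: reachable_conv')
  qed
  have "pverts ?G \<noteq> {}"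
    unfolding verts by simp
  \<comment> \<open>\<open>connected\<close> means strong connectedness of the symmetric closure, to
    which reachability passes.\<close>
  then show ?thesis
    unfolding connected_def strongly_connected_def
    using reachable by (auto intro: reachable_mk_symmetricI)
qed

end
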